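(* Every translation-invariant one-dimensional quantum walk is a Szegedy walk.
   Context: A quantum walk is a pair $(U,\{\mathcal H_v\}_{v\in V})$ where $V$ is a countable set, $\{\mathcal H_v\}_{v\in V}$ is a family of separable Hilbert spaces, and $U$ is a unitary operator on $\mathcal H=\bigoplus_{v\in V}\mathcal H_v$. $P_v$ is the orthogonal projection onto $\mathcal H_v$ and $U_{uv}=U_{u,v}=P_uUP_v$, also regarded as an operator from $\mathcal H_v$ to $\mathcal H_u$. The graph $(V,D)$ of the walk is the directed (multi)graph in which the number of directed edges from $v$ to $u$ is $\mathrm{card}(u,v)=\operatorname{rank}U_{uv}$. The walk is standard if its graph is locally finite and symmetric ($\mathrm{card}(u,v)=\mathrm{card}(v,u)$) and for every $v$ the number of edges with origin $v$ equals $\dim\mathcal H_v$. It is one-dimensional if $V=\mathbb Z$, $\dim\mathcal H_n=2$ for all $n$, and $\operatorname{rank}U_{m,n}=1$ when $|m-n|=1$ and $U_{m,n}=0$ otherwise (such walks are standard). A one-dimensional quantum walk is translation invariant if $\mathcal H_n=\mathcal H_{n+1}$ for all $n\in\mathbb Z$ (all summands are the same Hilbert space) and $U_{m,n}=U_{m+1,n+1}$ (as operators on this common space) for all $m,n\in\mathbb Z$. A standard quantum walk is a Szegedy walk if there exist a self-adjoint unitary operator $S$ on $\mathcal H$, a real number $\lambda$, and unit vectors $\phi_v\in\mathcal H_v$ such that $e^{\mathrm i\lambda}SU=\bigoplus_{v\in V}C_v$, where $C_v=2|\phi_v\rangle\langle\phi_v|-I_{\mathcal H_v}$ on $\mathcal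 H_v$. *)

theory Defs
  imports
    "HOL-Analysis.Analysis"
    "HOL-Library.Extended_Nat"
    "Graph_Theory.Digraph"
begin

section \<open>Complex inner product spaces\<close>

class complex_inner = real_normed_vector +
  fixes scaleC :: "complex \<Rightarrow> 'a \<Rightarrow> 'a" (infixr "*\<^sub>C" 75)
    and cinner :: "'a \<Rightarrow> 'a \<Rightarrow> complex"
  assumes scaleC_add_right: "c *\<^sub>C (x + y) = c *\<^sub>C x + c *\<^sub>C y"
    and scaleC_add_left: "(c + d) *\<^sub>C x = c *\<^sub>C x + d *\<^sub>C x"
    and scaleC_scaleC: "c *\<^sub>C d *\<^sub>C x = (c * d) *\<^sub>C x"
    and scaleR_scaleC: "r *\<^sub>R x = complex_of_real r *\<^sub>C x"
    and cinner_commute: "cinner x y = cnj (cinner y x)"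
    and cinner_add_right: "cinner x (y + z) = cinner x y + cinner x z"
    and cinner_scaleC_right: "cinner x (c *\<^sub>C y) = c * cinner x y"
    and cinner_self: "cinner x x = complex_of_real ((norm x)\<^sup>2)"

global_interpretation cvec: vector_space "scaleC :: complex \<Rightarrow> 'a \<Rightarrow> 'a::complex_inner"
proof
  show "1 *\<^sub>C x = x" for x :: 'a
    using scaleR_scaleC[of 1 x] by simp
qed (simp_all add: scaleC_add_right scaleC_add_left scaleC_scaleC)

text \<open>The standard instances \<open>\<complex>\<close> and \<open>\<complex>\<^sup>n\<close>.\<close>

instantiation complex :: complex_inner
begin

definition scaleC_complex :: "complex \<Rightarrow> complex \<Rightarrow> complex"
  where "scaleC_complex c x = c * x"

definition cinner_complex :: "complex \<Rightarrow> complex \<Rightarrow> complex"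
  where "cinner_complex x y = cnj x * y"

instance
proof
  show "cinner x x = complex_of_real ((norm x)\<^sup>2)" for x :: complex
    unfolding cinner_complex_def by (metis complex_norm_square mult.commute)
qed (simp_all add: scaleC_complex_def cinner_complex_def algebra_simps scaleR_conv_of_real)

end

instantiation vec :: (complex_inner, finite) complex_inner
begin

definition scaleC_vec :: "complex \<Rightarrow> 'a ^ 'b \<Rightarrow> 'a ^ 'b"
  where "scaleC_vec c x = (\<chi> i. c *\<^sub>C (x $ i))"

definition cinner_vec :: "'a ^ 'b \<Rightarrow> 'a ^ 'b \<Rightarrow> complex"
  where "cinner_vec x y = (\<Sum>i\<in>UNIV. cinner (x $ i) (y $ i))"

instance
proof
  fix x y z :: "'a ^ 'b" and c d :: complex and r :: real
  show "cinner x y = cnj (cinner y x)"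
    unfolding cinner_vec_def cnj_sum by (intro sum.cong refl cinner_commute)
  show "cinner x x = complex_of_real ((norm x)\<^sup>2)"
    unfolding cinner_vec_def norm_vec_def L2_set_def
    by (simp add: cinner_self sum_nonneg)
qed (simp_all add: scaleC_vec_def cinner_vec_def vec_eq_iff scaleC_add_right scaleC_add_left
    scaleC_scaleC scaleR_scaleC cinner_add_right cinner_scaleC_right sum.distrib sum_distrib_left)

end

text \<open>
  A family of Hilbert spaces is rendered by carrier sets inside one ambient complex inner product
  space, which need not itself be complete or separable.
\<close>

definition separable_hilbert :: "'a::complex_inner set \<Rightarrow> bool"
  where "separable_hilbert M \<longleftrightarrow>
    cvec.subspace M \<and> complete M \<and> separable_space (top_of_set M)"

text \<open>
  The library function \<^const>\<open>vector_space.dim\<close> is \<open>0\<close> on infinite-dimensional spaces, so the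
  infinite case is separated. All spaces below are separable, so \<open>\<infinity>\<close> stands for \<open>\<aleph>\<^sub>0\<close> throughout.
\<close>

definition cdim :: "'a::complex_inner set \<Rightarrow> enat"
  where "cdim M =
    (if \<exists>B. finite B \<and> M \<subseteq> cvec.span B then enat (cvec.dim M) else \<infinity>)"


section \<open>Hilbert direct sums\<close>

text \<open>
  A vector of \<open>\<Oplus>\<^sub>v H\<^sub>v\<close> is a square-summable family of components, extended by \<open>0\<close> outside \<open>V\<close>
  so that equality of vectors is equality of functions.
\<close>

definition direct_sum :: "'v set \<Rightarrow> ('v \<Rightarrow> 'a::complex_inner set) \<Rightarrow> ('v \<Rightarrow> 'a) set"
  where "direct_sum V H =
    {\<psi>. (\<forall>v\<in>V. \<psi> v \<in> H v) \<and> (\<forall>v. v \<notin> V \<longrightarrow> \<psi> v = 0) \<and> (\<lambda>v. (norm (\<psi> v))\<^sup>2) summable_on V}"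

definition ds_inner :: "'v set \<Rightarrow> ('v \<Rightarrow> 'a::complex_inner) \<Rightarrow> ('v \<Rightarrow> 'a) \<Rightarrow> complex"
  where "ds_inner V \<psi> \<phi> = (\<Sum>\<^sub>\<infinity>v\<in>V. cinner (\<psi> v) (\<phi> v))"

text \<open>Only the values of an operator on the carrier \<^const>\<open>direct_sum\<close> are meaningful.\<close>

definition linear_op ::
    "'v set \<Rightarrow> ('v \<Rightarrow> 'a::complex_inner set) \<Rightarrow> (('v \<Rightarrow> 'a) \<Rightarrow> ('v \<Rightarrow> 'a)) \<Rightarrow> bool"
  where "linear_op V H T \<longleftrightarrow>
    T \<in> direct_sum V H \<rightarrow> direct_sum V H \<and>
    (\<forall>\<psi>\<in>direct_sum V H. \<forall>\<phi>\<in>direct_sum V H. T (\<lambda>v. \<psi> v + \<phi> v) = (\<lambda>v. T \<psi> v + T \<phi> v)) \<and>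
    (\<forall>c. \<forall>\<psi>\<in>direct_sum V H. T (\<lambda>v. c *\<^sub>C \<psi> v) = (\<lambda>v. c *\<^sub>C T \<psi> v))"

definition unitary_op ::
    "'v set \<Rightarrow> ('v \<Rightarrow> 'a::complex_inner set) \<Rightarrow> (('v \<Rightarrow> 'a) \<Rightarrow> ('v \<Rightarrow> 'a)) \<Rightarrow> bool"
  where "unitary_op V H T \<longleftrightarrow>
    linear_op V H T \<and>
    bij_betw T (direct_sum V H) (direct_sum V H) \<and>
    (\<forall>\<psi>\<in>direct_sum V H. \<forall>\<phi>\<in>direct_sum V H. ds_inner V (T \<psi>) (T \<phi>) = ds_inner V \<psi> \<phi>)"

definition self_adjoint_op ::
    "'v set \<Rightarrow> ('v \<Rightarrow> 'a::complex_inner set) \<Rightarrow> (('v \<Rightarrow> 'a) \<Rightarrow> ('v \<Rightarrow> 'a)) \<Rightarrow> bool"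
  where "self_adjoint_op V H T \<longleftrightarrow>
    linear_op V H T \<and>
    (\<forall>\<psi>\<in>direct_sum V H. \<forall>\<phi>\<in>direct_sum V H. ds_inner V (T \<psi>) \<phi> = ds_inner V \<psi> (T \<phi>))"

definition embed :: "'v \<Rightarrow> 'a::complex_inner \<Rightarrow> 'v \<Rightarrow> 'a"
  where "embed v x = (\<lambda>w. if w = v then x else 0)"

text \<open>The orthogonal projection \<open>P\<^sub>v\<close> onto the copy of \<open>H\<^sub>v\<close> in the direct sum.\<close>

definition proj :: "'v \<Rightarrow> ('v \<Rightarrow> 'a::complex_inner) \<Rightarrow> 'v \<Rightarrow> 'a"
  where "proj v \<psi> = embed v (\<psi> v)"

definition sum_op :: "'v set \<Rightarrow> ('v \<Rightarrow> 'a \<Rightarrow> 'a::complex_inner) \<Rightarrow> ('v \<Rightarrow> 'a) \<Rightarrow> 'v \<Rightarrow> 'a"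
  where "sum_op V C \<psi> = (\<lambda>v. if v \<in> V then C v (\<psi> v) else 0)"


section \<open>Quantum walks\<close>

definition quantum_walk ::
    "'v set \<Rightarrow> ('v \<Rightarrow> 'a::complex_inner set) \<Rightarrow> (('v \<Rightarrow> 'a) \<Rightarrow> ('v \<Rightarrow> 'a)) \<Rightarrow> bool"
  where "quantum_walk V H U \<longleftrightarrow>
    countable V \<and> (\<forall>v\<in>V. separable_hilbert (H v)) \<and> unitary_op V H U"

text \<open>\<open>U\<^sub>u\<^sub>v = P\<^sub>u U P\<^sub>v\<close>, regarded as an operator from \<open>H\<^sub>v\<close> to \<open>H\<^sub>u\<close>.\<close>

definition block :: "(('v \<Rightarrow> 'a) \<Rightarrow> ('v \<Rightarrow> 'a)) \<Rightarrow> 'v \<Rightarrow> 'v \<Rightarrow> 'a \<Rightarrow> 'a::complex_inner"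
  where "block U u v x = (proj u \<circ> U \<circ> proj v) (embed v x) u"

definition block_rank ::
    "('v \<Rightarrow> 'a::complex_inner set) \<Rightarrow> (('v \<Rightarrow> 'a) \<Rightarrow> ('v \<Rightarrow> 'a)) \<Rightarrow> 'v \<Rightarrow> 'v \<Rightarrow> enat"
  where "block_rank H U u v = cdim (block U u v ` H v)"

text \<open>The arcs \<open>(v, u, k)\<close>, \<open>k < rank U\<^sub>u\<^sub>v\<close>, are the parallel edges from \<open>v\<close> to \<open>u\<close>.\<close>

definition walk_graph ::
    "'v set \<Rightarrow> ('v \<Rightarrow> 'a::complex_inner set) \<Rightarrow> (('v \<Rightarrow> 'a) \<Rightarrow> ('v \<Rightarrow> 'a))
      \<Rightarrow> ('v, 'v \<times> 'v \<times> nat) pre_digraph"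
  where "walk_graph V H U =
    \<lparr>verts = V,
     arcs = {(v, u, k). v \<in> V \<and> u \<in> V \<and> enat k < block_rank H U u v},
     tail = (\<lambda>(v, u, k). v),
     head = (\<lambda>(v, u, k). u)\<rparr>"

definition standard_walk ::
    "'v set \<Rightarrow> ('v \<Rightarrow> 'a::complex_inner set) \<Rightarrow> (('v \<Rightarrow> 'a) \<Rightarrow> ('v \<Rightarrow> 'a)) \<Rightarrow> bool"
  where "standard_walk V H U \<longleftrightarrow>
    quantum_walk V H U \<and>
    (\<forall>v\<in>V. finite (out_arcs (walk_graph V H U) v) \<and> finite (in_arcs (walk_graph V H U) v)) \<and>
    (\<forall>u\<in>V. \<forall>v\<in>V. block_rank H U u v = block_rank H U v u) \<and>
    (\<forall>v\<in>V. enat (out_degree (walk_graph V H U) v) = cdim (H v))"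

definition one_dimensional_walk ::
    "(int \<Rightarrow> 'a::complex_inner set) \<Rightarrow> ((int \<Rightarrow> 'a) \<Rightarrow> (int \<Rightarrow> 'a)) \<Rightarrow> bool"
  where "one_dimensional_walk H U \<longleftrightarrow>
    quantum_walk UNIV H U \<and>
    (\<forall>n. cdim (H n) = 2) \<and>
    (\<forall>m n. \<bar>m - n\<bar> = 1 \<longrightarrow> block_rank H U m n = 1) \<and>
    (\<forall>m n. \<bar>m - n\<bar> \<noteq> 1 \<longrightarrow> (\<forall>x\<in>H n. block U m n x = 0))"

definition translation_invariant ::
    "(int \<Rightarrow> 'a::complex_inner set) \<Rightarrow> ((int \<Rightarrow> 'a) \<Rightarrow> (int \<Rightarrow> 'a)) \<Rightarrow> bool"
  where "translation_invariant H U \<longleftrightarrow>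
    (\<forall>n. H n = H (n + 1)) \<and>
    (\<forall>m n. \<forall>x\<in>H n. block U m n x = block U (m + 1) (n + 1) x)"

text \<open>\<open>2|\<phi>\<rangle>\<langle>\<phi>| - I\<close>\<close>

definition coin :: "'a::complex_inner \<Rightarrow> 'a \<Rightarrow> 'a"
  where "coin \<phi> x = 2 *\<^sub>C cinner \<phi> x *\<^sub>C \<phi> - x"

definition szegedy_walk ::
    "'v set \<Rightarrow> ('v \<Rightarrow> 'a::complex_inner set) \<Rightarrow> (('v \<Rightarrow> 'a) \<Rightarrow> ('v \<Rightarrow> 'a)) \<Rightarrow> bool"
  where "szegedy_walk V H U \<longleftrightarrow>
    standard_walk V H U \<and>
    (\<exists>S (l::real) \<phi>.
      unitary_op V H S \<and> self_adjoint_op V H S \<and>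
      (\<forall>v\<in>V. \<phi> v \<in> H v \<and> norm (\<phi> v) = 1) \<and>
      (\<forall>\<psi>\<in>direct_sum V H.
        (\<lambda>v. exp (\<i> * complex_of_real l) *\<^sub>C S (U \<psi>) v) = sum_op V (\<lambda>v. coin (\<phi> v)) \<psi>))"

end

theory Submission
  imports Defs
begin

text \<open>
  Translation invariance makes all blocks \<open>U\<^sub>n\<^sub>+\<^sub>1\<^sub>,\<^sub>n\<close> equal to one rank-one operator and all blocks
  \<open>U\<^sub>n\<^sub>-\<^sub>1\<^sub>,\<^sub>n\<close> equal to another one. Unitarity forces these to be \<open>|u\<rangle>\<langle>v|\<close> and \<open>|u'\<rangle>\<langle>v'|\<close> for two
  orthonormal bases \<open>u, u'\<close> and \<open>v, v'\<close> of the two-dimensional fibre. There is a unit vector \<open>\<phi>\<close>,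
  proportional to \<open>v + \<alpha> u'\<close> for a suitable phase \<open>\<alpha>\<close>, whose coin sends \<open>v\<close> to \<open>\<alpha> u'\<close>; being unitary,
  the coin then sends \<open>v'\<close> to \<open>\<beta> u\<close> for another phase \<open>\<beta>\<close>. With \<open>exp (2 \<i> \<lambda>) = \<alpha> \<beta>\<close>, the operator
  \<open>S = exp (-\<i> \<lambda>) C U\<^sup>*\<close> exchanges, up to conjugate phases, the component of \<open>u'\<close> at \<open>n - 1\<close> with that
  of \<open>u\<close> at \<open>n\<close>, and so is a self-adjoint unitary.
\<close>

section \<open>Complex inner product spaces\<close>

lemma cinner_add_left: "cinner (x + y) (z::'a::complex_inner) = cinner x z + cinner y z"
  by (metis cinner_commute cinner_add_right complex_cnj_add)

lemma cinner_scaleC_left: "cinner (c *\<^sub>C x) (z::'a::complex_inner) = cnj c * cinner x z"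
  by (metis cinner_commute cinner_scaleC_right complex_cnj_mult)

lemma cinner_zero_right [simp]: "cinner (x::'a::complex_inner) 0 = 0"
  using cinner_add_right[of x 0 0] by simp

lemma cinner_zero_left [simp]: "cinner 0 (x::'a::complex_inner) = 0"
  using cinner_add_left[of 0 0 x] by simp

lemma cinner_diff_right: "cinner (x::'a::complex_inner) (y - z) = cinner x y - cinner x z"
  using cinner_add_right[of x "y - z" z] by simp

lemma cinner_diff_left: "cinner (y - z) (x::'a::complex_inner) = cinner y x - cinner z x"
  using cinner_add_left[of "y - z" z x] by simp

lemmas cinner_simps = cinner_add_left cinner_add_right cinner_diff_left cinner_diff_right
  cinner_scaleC_left cinner_scaleC_right

lemma cinner_eq_0_commute: "cinner x y = 0 \<Longrightarrow> cinner y (x::'a::complex_inner) = 0"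
  by (subst cinner_commute) simp

lemma cinner_self_eq_0_iff [simp]: "cinner x x = 0 \<longleftrightarrow> (x::'a::complex_inner) = 0"
  by (simp add: cinner_self)

lemma cinner_self_unit: "norm (x::'a::complex_inner) = 1 \<Longrightarrow> cinner x x = 1"
  by (simp add: cinner_self)

lemma norm_eq_1_iff_cinner: "norm (x::'a::complex_inner) = 1 \<longleftrightarrow> cinner x x = 1"
proof -
  have "cinner x x = 1 \<longleftrightarrow> (norm x)\<^sup>2 = 1"
    unfolding cinner_self by (metis of_real_1 of_real_eq_iff)
  then show ?thesis by (simp add: abs_square_eq_1)
qed

lemma norm_scaleC: "norm (c *\<^sub>C (x::'a::complex_inner)) = cmod c * norm x"
proof -
  have "complex_of_real ((norm (c *\<^sub>C x))\<^sup>2) = (c * cnj c) * cinner x x"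
    by (simp only: cinner_self[symmetric] cinner_simps mult_ac)
  also have "\<dots> = complex_of_real ((cmod c * norm x)\<^sup>2)"
    by (simp only: cinner_self complex_norm_square[symmetric] power_mult_distrib of_real_mult)
  finally have "complex_of_real ((norm (c *\<^sub>C x))\<^sup>2) = complex_of_real ((cmod c * norm x)\<^sup>2)" .
  then have "(norm (c *\<^sub>C x))\<^sup>2 = (cmod c * norm x)\<^sup>2" using of_real_eq_iff by blast
  then show ?thesis by simp
qed

lemma cinner_ext_subspace:
  assumes "cvec.subspace K" "x \<in> K" "y \<in> K" "\<And>z. z \<in> K \<Longrightarrow> cinner z x = cinner z y"
  shows "x = (y::'a::complex_inner)"
proof -
  have "cinner (x - y) (x - y) = 0"
    using assms cvec.subspace_diff[of K x y] by (simp add: cinner_diff_right)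
  then show ?thesis by simp
qed

section \<open>Orthonormal bases of two-dimensional subspaces\<close>

definition onb2 :: "'a::complex_inner set \<Rightarrow> 'a \<Rightarrow> 'a \<Rightarrow> bool"
  where "onb2 K u w \<longleftrightarrow> u \<in> K \<and> w \<in> K \<and> norm u = 1 \<and> norm w = 1 \<and> cinner u w = 0 \<and>
    (\<forall>x\<in>K. x = cinner u x *\<^sub>C u + cinner w x *\<^sub>C w)"

lemma onb2_cinner:
  assumes "onb2 K u w"
  shows "cinner u u = 1" "cinner w w = 1" "cinner u w = 0" "cinner w u = 0"
  using assms by (auto simp: onb2_def cinner_self_unit cinner_eq_0_commute)

lemma onb2_expand: "onb2 K u w \<Longrightarrow> x \<in> K \<Longrightarrow> x = cinner u x *\<^sub>C u + cinner w x *\<^sub>C w"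
  by (simp add: onb2_def)

lemma onb2_norm_combination:
  assumes "onb2 K u w"
  shows "(norm (a *\<^sub>C u + b *\<^sub>C w))\<^sup>2 = (cmod a)\<^sup>2 + (cmod b)\<^sup>2"
proof -
  have "complex_of_real ((norm (a *\<^sub>C u + b *\<^sub>C w))\<^sup>2) = complex_of_real ((cmod a)\<^sup>2 + (cmod b)\<^sup>2)"
    unfolding cinner_self[symmetric]
    by (simp add: cinner_simps onb2_cinner[OF assms] complex_norm_square mult.commute
        del: of_real_power)
  then show ?thesis using of_real_eq_iff by blast
qed

lemma onb2_norm:
  assumes "onb2 K u w" "x \<in> K"
  shows "(norm x)\<^sup>2 = (cmod (cinner u x))\<^sup>2 + (cmod (cinner w x))\<^sup>2"
  using onb2_norm_combination[OF assms(1), of "cinner u x" "cinner w x"]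
    onb2_expand[OF assms] by simp

text \<open>Only the expansion clause needs an argument: if some \<open>x\<close> in
  \<open>K\<close> failed it, the nonzero residual \<open>r\<close> would be orthogonal to
  \<open>u\<close> and \<open>w\<close>, giving three independent vectors in a space of dimension
  2.\<close>

lemma onb2I:
  assumes K: "cvec.subspace K" "cdim K = 2"
    and u: "u \<in> K" "norm u = 1" and w: "w \<in> K" "norm w = 1" and uw: "cinner u w = 0"
  shows "onb2 (K::'a::complex_inner set) u w"
proof -
  have uu: "cinner u u = 1" "cinner w w = 1" "cinner w u = 0"
    using u w uw by (auto simp: cinner_self_unit cinner_eq_0_commute)
  from K(2) have dimK: "cvec.dim K = 2"
    unfolding cdim_def by (auto simp: numeral_eq_enat split: if_splits)
  obtain B where B: "B \<subseteq> K" "cvec.independent B" "K \<subseteq> cvec.span B" "card B = 2"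
    using cvec.basis_exists[of K] dimK by metis
  then have finB: "finite B" by (metis card.infinite zero_neq_numeral)
  have "x = cinner u x *\<^sub>C u + cinner w x *\<^sub>C w" if x: "x \<in> K" for x
  proof (rule ccontr)
    define r where "r = x - cinner u x *\<^sub>C u - cinner w x *\<^sub>C w"
    assume "x \<noteq> cinner u x *\<^sub>C u + cinner w x *\<^sub>C w"
    then have r0: "r \<noteq> 0" by (simp add: r_def algebra_simps)
    have rK: "r \<in> K" unfolding r_def
      by (intro cvec.subspace_diff cvec.subspace_scale K x u w)
    have ru: "cinner r u = 0" "cinner r w = 0"
      by (rule cinner_eq_0_commute, simp add: r_def cinner_simps uu uw)+
    have w_nz: "w \<noteq> 0" and u_nz: "u \<noteq> 0" using u w by auto
    have "u \<notin> cvec.span {w}"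
    proof
      assume "u \<in> cvec.span {w}"
      then obtain k where "u = k *\<^sub>C w" by (auto simp: cvec.span_singleton)
      then have "cinner u u = 0" using uw by (simp add: cinner_simps uu)
      then show False using u_nz by simp
    qed
    moreover have "r \<notin> cvec.span {u, w}"
    proof
      assume "r \<in> cvec.span {u, w}"
      then obtain k l where "r = k *\<^sub>C u + l *\<^sub>C w"
        by (auto simp: cvec.span_breakdown_eq cvec.span_singleton algebra_simps)
      then have "cinner r r = 0" using ru by (simp add: cinner_simps)
      then show False using r0 by simp
    qed
    moreover have "u \<noteq> w" using uu uw by auto
    moreover have "r \<noteq> u" "r \<noteq> w" using ru uu by auto
    ultimately have ind: "cvec.independent {r, u, w}" and card: "card {r, u, w} = 3"
      using w_nz by (auto simp: cvec.independent_insert)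
    have "{r, u, w} \<subseteq> cvec.span B" using rK u w B by auto
    from cvec.independent_span_bound[OF finB ind this] show False using card B by simp
  qed
  then show ?thesis using assms by (simp add: onb2_def)
qed

text \<open>Meant for the image of a block, taken as a bare set: \<open>u\<close> is not claimed to
  lie in \<open>M\<close>, so \<open>a\<close> and the scaling are exported to carry orthogonality
  and membership in a subspace over from \<open>a\<close> to \<open>u\<close>.\<close>

lemma cdim_1_obtain_unit:
  assumes "cdim (M::'a::complex_inner set) = 1"
  obtains a u where "a \<in> M" "norm u = 1" "u = complex_of_real (inverse (norm a)) *\<^sub>C a"
    "\<And>x. x \<in> M \<Longrightarrow> \<exists>k. x = k *\<^sub>C u"
proof -
  have "cvec.dim M = 1"
    using assms unfolding cdim_def by (auto simp: one_enat_def split: if_splits)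
  then obtain B where B: "B \<subseteq> M" "cvec.independent B" "M \<subseteq> cvec.span B" "card B = 1"
    using cvec.basis_exists[of M] by metis
  then obtain a where a: "B = {a}" by (auto simp: card_1_singleton_iff)
  with B have a0: "a \<noteq> 0" by auto
  define u where "u = complex_of_real (inverse (norm a)) *\<^sub>C a"
  have au: "a = complex_of_real (norm a) *\<^sub>C u"
    using a0 by (simp add: u_def scaleC_scaleC flip: of_real_mult)
  show thesis
  proof (rule that)
    show "norm u = 1" using a0 by (simp add: u_def norm_scaleC norm_inverse)
    show "\<exists>k. x = k *\<^sub>C u" if "x \<in> M" for x
    proof -
      have "x \<in> range (\<lambda>k. k *\<^sub>C a)" using that B a by (auto simp: cvec.span_singleton)
      then obtain k where "x = k *\<^sub>C a" by blast
      then show ?thesis by (subst (asm) au) (auto simp: scaleC_scaleC)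
    qed
  qed (use B a u_def in auto)
qed

section \<open>Coins\<close>

lemma coin_in_subspace:
  "cvec.subspace K \<Longrightarrow> \<phi> \<in> K \<Longrightarrow> x \<in> K \<Longrightarrow> coin \<phi> x \<in> K"
  unfolding coin_def by (intro cvec.subspace_diff cvec.subspace_scale)

lemma coin_add: "coin \<phi> (x + y) = coin \<phi> x + coin \<phi> y"
  by (simp add: coin_def cinner_add_right scaleC_add_left scaleC_add_right)

lemma coin_scaleC: "coin \<phi> (c *\<^sub>C x) = c *\<^sub>C coin \<phi> x"
  by (simp add: coin_def cinner_scaleC_right scaleC_scaleC cvec.scale_right_diff_distrib mult_ac)

text \<open>For a unit vector the multiples 4, -2 and -2 of
  \<open>cinner x \<phi> * cinner \<phi> y\<close> cancel, as for any reflection.\<close>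

lemma cinner_coin:
  assumes "norm \<phi> = 1"
  shows "cinner (coin \<phi> x) (coin \<phi> y) = cinner x y"
proof -
  have "cinner x \<phi> = cnj (cinner \<phi> x)" by (rule cinner_commute)
  then show ?thesis
    by (simp add: coin_def cinner_simps cinner_self_unit[OF assms] algebra_simps)
qed

text \<open>
  The phase makes \<open>\<alpha> \<langle>x, y\<rangle>\<close> real, so that the reflection in the bisector \<open>x + \<alpha> y\<close> exchanges \<open>x\<close> and
  \<open>\<alpha> y\<close>; taking it non-negative keeps the bisector away from \<open>0\<close>.
\<close>

lemma coin_exchange:
  fixes x y :: "'a::complex_inner"
  assumes K: "cvec.subspace K" "x \<in> K" "y \<in> K" and unit: "norm x = 1" "norm y = 1"
  obtains \<phi> \<alpha> where "\<phi> \<in> K" "norm \<phi> = 1" "cmod \<alpha> = 1" "coin \<phi> x = \<alpha> *\<^sub>C y"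
proof -
  define z where "z = cinner x y"
  \<comment> \<open>\<open>Arg 0\<close> is 0, so \<open>\<alpha> = 1\<close> when \<open>x\<close>
    and \<open>y\<close> are orthogonal.\<close>
  define \<alpha> where "\<alpha> = cis (- Arg z)"
  have [simp]: "cmod \<alpha> = 1" by (simp add: \<alpha>_def)
  have z: "z = complex_of_real (cmod z) * cis (Arg z)"
    using rcis_cmod_Arg[of z] by (simp add: rcis_def)
  have az: "\<alpha> * z = complex_of_real (cmod z)"
    by (subst z) (simp add: \<alpha>_def cis_mult)
  then have az': "cnj \<alpha> * cnj z = complex_of_real (cmod z)"
    by (metis complex_cnj_complex_of_real complex_cnj_mult)
  have yx: "cinner y x = cnj z" unfolding z_def by (rule cinner_commute)
  have aa: "\<alpha> * cnj \<alpha> = 1" using complex_norm_square[of \<alpha>] by simp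
  define w where "w = x + \<alpha> *\<^sub>C y"
  define s where "s = 1 + cmod z"
  have s0: "s > 0" by (simp add: s_def add_pos_nonneg)
  have wx: "cinner w x = complex_of_real s"
    by (simp add: w_def s_def cinner_simps cinner_self_unit unit yx az')
  have "cinner w w = 2 * complex_of_real s"
    using aa by (simp add: w_def s_def cinner_simps cinner_self_unit unit yx az az' z_def[symmetric]
        distrib_left mult.commute)
  then have "complex_of_real ((norm w)\<^sup>2) = complex_of_real (2 * s)" by (simp add: cinner_self)
  then have nw: "(norm w)\<^sup>2 = 2 * s" using of_real_eq_iff by blast
  then have w0: "norm w > 0" using s0 by (auto simp: zero_less_norm_iff)
  define \<phi> where "\<phi> = complex_of_real (inverse (norm w)) *\<^sub>C w"
  \<comment> \<open>With \<open>cinner w x = s\<close> and \<open>(norm w)\<^sup>2 = 2 * s\<close>,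
    the coefficient \<open>2 * cinner w x / (norm w)\<^sup>2\<close> of the reflection is 1, so the
    coin sends \<open>x\<close> to \<open>w - x\<close>.\<close>
  have "2 * (inverse (norm w) * s) * inverse (norm w) = 1"
    using w0 nw s0 by (simp add: field_simps power2_eq_square)
  then have *: "2 * (complex_of_real (inverse (norm w)) * complex_of_real s) *
      complex_of_real (inverse (norm w)) = 1"
    by (metis of_real_1 of_real_mult of_real_numeral)
  show thesis
  proof
    show "\<phi> \<in> K" unfolding \<phi>_def w_def
      by (intro cvec.subspace_scale cvec.subspace_add K)
    show "norm \<phi> = 1" using w0 by (simp add: \<phi>_def norm_scaleC norm_inverse)
    show "cmod \<alpha> = 1" by simp
    have "coin \<phi> x = (2 * (complex_of_real (inverse (norm w)) * complex_of_real s) *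
      complex_of_real (inverse (norm w))) *\<^sub>C w - x"
      unfolding coin_def \<phi>_def by (simp add: cinner_simps wx scaleC_scaleC mult.assoc)
    then show "coin \<phi> x = \<alpha> *\<^sub>C y" unfolding * by (simp add: w_def)
  qed
qed

section \<open>Vectors supported at one vertex\<close>

lemma embed_simps [simp]: "embed v x v = x" "w \<noteq> v \<Longrightarrow> embed v x w = 0"
  by (simp_all add: embed_def)

lemma embed_in_direct_sum:
  assumes "v \<in> V" "x \<in> H v" "\<And>w. w \<in> V \<Longrightarrow> cvec.subspace (H w)"
  shows "embed v x \<in> direct_sum V H"
proof -
  have "(\<lambda>w. (norm (embed v x w))\<^sup>2) summable_on V"
    by (rule finite_nonzero_values_imp_summable_on, rule finite_subset[of _ "{v}"])
      (auto simp: embed_def split: if_splits)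
  then show ?thesis using assms by (auto simp: direct_sum_def embed_def cvec.subspace_0)
qed

lemma ds_inner_embed_left:
  assumes "v \<in> V"
  shows "ds_inner V (embed v x) \<psi> = cinner x (\<psi> v)"
proof -
  have "ds_inner V (embed v x) \<psi> = (\<Sum>\<^sub>\<infinity>w\<in>{v}. cinner (embed v x w) (\<psi> w))"
    unfolding ds_inner_def using assms by (intro infsum_cong_neutral) (auto simp: embed_def)
  then show ?thesis by simp
qed

lemma ds_inner_embed_right:
  assumes "v \<in> V"
  shows "ds_inner V \<psi> (embed v x) = cinner (\<psi> v) x"
proof -
  have "ds_inner V \<psi> (embed v x) = (\<Sum>\<^sub>\<infinity>w\<in>{v}. cinner (\<psi> w) (embed v x w))"
    unfolding ds_inner_def using assms by (intro infsum_cong_neutral) (auto simp: embed_def)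
  then show ?thesis by simp
qed

lemma block_eq: "block U u v x = U (embed v x) u"
  by (simp add: block_def proj_def)

section \<open>Flip-flop shifts\<close>

lemma summable_on_int_shift:
  "(\<lambda>n. f (n + k)) summable_on UNIV \<longleftrightarrow> f summable_on (UNIV :: int set)"
  by (rule summable_on_reindex_bij_betw) (rule bij_plus_right)

lemma infsum_int_shift:
  "infsum (\<lambda>n. f (n + k)) UNIV = infsum f (UNIV :: int set)"
  by (rule infsum_reindex_bij_betw) (rule bij_plus_right)

text \<open>Domination by 2ab <= a^2 + b^2, where ab >= 0 absorbs the factor 2. This convergence
  later permits splitting inner product sums.\<close>

lemma summable_on_mult_of_squares:
  fixes f g :: "'i \<Rightarrow> complex"
  assumes "(\<lambda>n. (cmod (f n))\<^sup>2) summable_on A" "(\<lambda>n. (cmod (g n))\<^sup>2) summable_on A"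
  shows "(\<lambda>n. f n * g n) summable_on A"
proof (rule abs_summable_summable, rule Infinite_Sum.abs_summable_on_comparison_test')
  show "(\<lambda>n. (cmod (f n))\<^sup>2 + (cmod (g n))\<^sup>2) summable_on A"
    by (rule summable_on_add[OF assms])
  show "norm (f n * g n) \<le> (cmod (f n))\<^sup>2 + (cmod (g n))\<^sup>2" for n
    using sum_squares_bound[of "cmod (f n)" "cmod (g n)"]
      mult_nonneg_nonneg[OF norm_ge_zero[of "f n"] norm_ge_zero[of "g n"]]
    unfolding norm_mult by linarith
qed

text \<open>For an orthonormal basis \<open>u\<close>, \<open>w\<close>, each edge contributes an
  invariant plane spanned by \<open>u\<close> at \<open>n\<close> and \<open>w\<close> at
  \<open>n - 1\<close>; there the operator is the Hermitian matrix with zero diagonal and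
  off-diagonal entries \<open>\<gamma>\<close> and \<open>cnj \<gamma>\<close>.\<close>

definition flip_flop ::
    "complex \<Rightarrow> 'a::complex_inner \<Rightarrow> 'a \<Rightarrow> (int \<Rightarrow> 'a) \<Rightarrow> int \<Rightarrow> 'a"
  where "flip_flop \<gamma> u w \<psi> =
    (\<lambda>n. (\<gamma> * cinner w (\<psi> (n - 1))) *\<^sub>C u + (cnj \<gamma> * cinner u (\<psi> (n + 1))) *\<^sub>C w)"

context
  fixes K :: "'a::complex_inner set" and u w :: 'a and \<gamma> :: complex
  assumes K: "cvec.subspace K" and onb: "onb2 K u w" and \<gamma>: "cmod \<gamma> = 1"
begin

lemma summable_on_component:
  assumes "\<psi> \<in> direct_sum UNIV (\<lambda>_::int. K)"
  shows "(\<lambda>n. (cmod (cinner u (\<psi> n)))\<^sup>2) summable_on UNIV"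
    and "(\<lambda>n. (cmod (cinner w (\<psi> n)))\<^sup>2) summable_on UNIV"
proof -
  have s: "(\<lambda>n. (norm (\<psi> n))\<^sup>2) summable_on UNIV" and k: "\<psi> n \<in> K" for n
    using assms by (auto simp: direct_sum_def)
  show "(\<lambda>n. (cmod (cinner u (\<psi> n)))\<^sup>2) summable_on UNIV"
    by (rule summable_on_comparison_test[OF s]) (simp_all add: onb2_norm[OF onb k])
  show "(\<lambda>n. (cmod (cinner w (\<psi> n)))\<^sup>2) summable_on UNIV"
    by (rule summable_on_comparison_test[OF s]) (simp_all add: onb2_norm[OF onb k])
qed

lemma flip_flop_in_direct_sum:
  assumes \<psi>: "\<psi> \<in> direct_sum UNIV (\<lambda>_. K)"
  shows "flip_flop \<gamma> u w \<psi> \<in> direct_sum UNIV (\<lambda>_. K)"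
proof -
  \<comment> \<open>By orthonormality the squared norm at \<open>n\<close> is the sum of these two
    terms, each a shift of a summable family; the unimodular phases drop out.\<close>
  have "(\<lambda>n. (cmod (cinner w (\<psi> (n + -1))))\<^sup>2 + (cmod (cinner u (\<psi> (n + 1))))\<^sup>2) summable_on UNIV"
    by (intro summable_on_add summable_on_component[OF \<psi>, THEN summable_on_int_shift[THEN iffD2]])
  then have "(\<lambda>n. (norm (flip_flop \<gamma> u w \<psi> n))\<^sup>2) summable_on UNIV"
    by (simp add: flip_flop_def onb2_norm_combination[OF onb] norm_mult \<gamma>)
  moreover have "flip_flop \<gamma> u w \<psi> n \<in> K" for n
    using onb unfolding flip_flop_def
    by (intro cvec.subspace_add cvec.subspace_scale K) (auto simp: onb2_def)
  ultimately show ?thesis by (simp add: direct_sum_def)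
qed

text \<open>Crossing an edge and returning picks up both \<open>\<gamma>\<close> and
  \<open>cnj \<gamma>\<close>, whose product is 1.\<close>

lemma flip_flop_flip_flop:
  assumes "\<psi> \<in> direct_sum UNIV (\<lambda>_. K)"
  shows "flip_flop \<gamma> u w (flip_flop \<gamma> u w \<psi>) = \<psi>"
proof
  fix n
  have "\<gamma> * cnj \<gamma> = 1" using complex_norm_square[of \<gamma>] \<gamma> by simp
  then have c: "\<gamma> * (cnj \<gamma> * z) = z" "cnj \<gamma> * (\<gamma> * z) = z" for z
    by (simp_all add: mult.assoc[symmetric] mult.commute[of "cnj \<gamma>"])
  have "\<psi> n \<in> K" using assms by (simp add: direct_sum_def)
  from onb2_expand[OF onb this] show "flip_flop \<gamma> u w (flip_flop \<gamma> u w \<psi>) n = \<psi> n"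
    by (simp add: flip_flop_def cinner_simps onb2_cinner[OF onb] c)
qed

lemma linear_op_flip_flop: "linear_op UNIV (\<lambda>_. K) (flip_flop \<gamma> u w)"
  unfolding linear_op_def
proof (intro conjI ballI allI)
  show "flip_flop \<gamma> u w \<in> direct_sum UNIV (\<lambda>_. K) \<rightarrow> direct_sum UNIV (\<lambda>_. K)"
    using flip_flop_in_direct_sum by blast
qed (simp_all add: flip_flop_def cinner_simps scaleC_add_left scaleC_add_right scaleC_scaleC
    distrib_left algebra_simps)

lemma self_adjoint_flip_flop: "self_adjoint_op UNIV (\<lambda>_. K) (flip_flop \<gamma> u w)"
  unfolding self_adjoint_op_def
proof (intro conjI ballI linear_op_flip_flop)
  fix \<psi> \<phi>
  assume \<psi>: "\<psi> \<in> direct_sum UNIV (\<lambda>_::int. K)" and \<phi>: "\<phi> \<in> direct_sum UNIV (\<lambda>_::int. K)"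
  \<comment> \<open>\<open>P n\<close> and \<open>Q n\<close> are the contributions of the edge
    between \<open>n\<close> and \<open>n + 1\<close>. On the left side \<open>P\<close> enters
    shifted by one and \<open>Q\<close> in place, on the right the other way round; sums over all
    integers ignore the shift.\<close>
  define P where "P n = cnj \<gamma> * (cnj (cinner w (\<psi> n)) * cinner u (\<phi> (n + 1)))" for n
  define Q where "Q n = \<gamma> * (cnj (cinner u (\<psi> (n + 1))) * cinner w (\<phi> n))" for n
  have P: "P summable_on UNIV" unfolding P_def
    using summable_on_component[OF \<psi>] summable_on_component[OF \<phi>]
    by (intro summable_on_cmult_right summable_on_mult_of_squares)
      (simp_all add: summable_on_int_shift[where f="\<lambda>n. (cmod (cinner u (\<phi> n)))\<^sup>2"])
  have Q: "Q summable_on UNIV" unfolding Q_def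
    using summable_on_component[OF \<psi>] summable_on_component[OF \<phi>]
    by (intro summable_on_cmult_right summable_on_mult_of_squares)
      (simp_all add: summable_on_int_shift[where f="\<lambda>n. (cmod (cinner u (\<psi> n)))\<^sup>2"])
  have P': "(\<lambda>n. P (n + -1)) summable_on UNIV" and Q': "(\<lambda>n. Q (n + -1)) summable_on UNIV"
    using P Q by (simp_all only: summable_on_int_shift)
  have com: "cinner (\<psi> n) x = cnj (cinner x (\<psi> n))" for n x by (rule cinner_commute)
  have "ds_inner UNIV (flip_flop \<gamma> u w \<psi>) \<phi> = (\<Sum>\<^sub>\<infinity>n. P (n + -1) + Q n)"
    unfolding ds_inner_def
    by (intro infsum_cong) (simp add: flip_flop_def cinner_simps P_def Q_def mult_ac)
  also have "\<dots> = infsum P UNIV + infsum Q UNIV"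
    by (simp only: infsum_add[OF P' Q] infsum_int_shift)
  also have "\<dots> = (\<Sum>\<^sub>\<infinity>n. P n + Q (n + -1))"
    by (simp only: infsum_add[OF P Q'] infsum_int_shift)
  also have "\<dots> = ds_inner UNIV \<psi> (flip_flop \<gamma> u w \<phi>)"
    unfolding ds_inner_def
    by (intro infsum_cong) (simp add: flip_flop_def cinner_simps com P_def Q_def mult_ac)
  finally show "ds_inner UNIV (flip_flop \<gamma> u w \<psi>) \<phi> = ds_inner UNIV \<psi> (flip_flop \<gamma> u w \<phi>)" .
qed

text \<open>A self-adjoint involution is its own inverse, and moving one factor across the inner
  product cancels both.\<close>

lemma unitary_flip_flop: "unitary_op UNIV (\<lambda>_. K) (flip_flop \<gamma> u w)"
  unfolding unitary_op_def
proof (intro conjI ballI linear_op_flip_flop)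
  show "bij_betw (flip_flop \<gamma> u w) (direct_sum UNIV (\<lambda>_. K)) (direct_sum UNIV (\<lambda>_. K))"
    by (rule bij_betw_byWitness[where f'="flip_flop \<gamma> u w"])
      (auto simp: flip_flop_flip_flop flip_flop_in_direct_sum)
  show "ds_inner UNIV (flip_flop \<gamma> u w \<psi>) (flip_flop \<gamma> u w \<phi>) = ds_inner UNIV \<psi> \<phi>"
    if "\<psi> \<in> direct_sum UNIV (\<lambda>_. K)" "\<phi> \<in> direct_sum UNIV (\<lambda>_. K)" for \<psi> \<phi>
    using self_adjoint_flip_flop that
    by (simp add: self_adjoint_op_def flip_flop_in_direct_sum flip_flop_flip_flop)
qed

end

section \<open>One-dimensional walks\<close>

lemma block_rank_zero:
  assumes "\<And>x. x \<in> H v \<Longrightarrow> block U u v x = 0"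
  shows "block_rank H U u v = 0"
proof -
  have sub: "block U u v ` H v \<subseteq> cvec.span {}" using assms by auto
  then have "cvec.dim (block U u v ` H v) = 0"
    using cvec.dim_unique[OF _ sub cvec.independent_empty] by simp
  moreover have "\<exists>B. finite B \<and> block U u v ` H v \<subseteq> cvec.span B"
    using sub by (intro exI[of _ "{}"]) blast
  ultimately show ?thesis unfolding block_rank_def cdim_def by (simp add: zero_enat_def)
qed

text \<open>The rank conditions leave exactly one arc to and from each neighbour, so the out-degree
  2 matches the fibre dimension.\<close>

lemma one_dimensional_standard:
  assumes "one_dimensional_walk H U"
  shows "standard_walk UNIV H U"
proof -
  have r1: "block_rank H U m n = 1" if "\<bar>m - n\<bar> = 1" for m n
    using assms that by (simp add: one_dimensional_walk_def)
  have r0: "block_rank H U m n = 0" if "\<bar>m - n\<bar> \<noteq> 1" for m n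
    using assms that by (intro block_rank_zero) (auto simp: one_dimensional_walk_def)
  have rank: "block_rank H U m n = (if \<bar>m - n\<bar> = 1 then 1 else 0)" for m n
    using r0 r1 by simp
  have arcs: "enat k < block_rank H U m n \<longleftrightarrow> (m = n + 1 \<or> m = n - 1) \<and> k = 0" for k m n
    unfolding rank by (auto simp: zero_enat_def one_enat_def)
  have out: "out_arcs (walk_graph UNIV H U) n = {(n, n + 1, 0), (n, n - 1, 0)}" for n
    by (auto simp: out_arcs_def walk_graph_def arcs)
  have "in": "in_arcs (walk_graph UNIV H U) n = {(n + 1, n, 0), (n - 1, n, 0)}" for n
    by (auto simp: in_arcs_def walk_graph_def arcs)
  have "block_rank H U m n = block_rank H U n m" for m n
    by (simp add: rank abs_minus_commute)
  then show ?thesis using assms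
    by (simp add: standard_walk_def one_dimensional_walk_def out "in" out_degree_def
        numeral_eq_enat)
qed

section \<open>Normal form of translation-invariant walks\<close>

lemma int_shift_invariant:
  fixes f :: "int \<Rightarrow> 'b"
  assumes "\<And>n. f n = f (n + 1)"
  shows "f n = f m"
proof -
  have "f n = f 0" for n
    by (induction n rule: int_induct[where k=0]) (metis assms diff_add_cancel)+
  then show ?thesis by metis
qed

text \<open>
  If the component along \<open>u\<close> at \<open>n\<close> is only fed from the vertex \<open>n - d\<close>, then \<open>U\<^sup>*\<close> maps \<open>u\<close> at \<open>n\<close>
  to a vector \<open>v\<close> at \<open>n - d\<close>.
\<close>

lemma unitary_preimage_embed:
  fixes K :: "'a::complex_inner set" and d :: int
  assumes U: "unitary_op UNIV (\<lambda>_. K) U" and K: "cvec.subspace K" and u: "u \<in> K"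
    and inv: "\<And>n y. y \<in> K \<Longrightarrow> U (embed (n - d) y) n = U (embed (0 - d) y) 0"
    and orth: "\<And>m n y. y \<in> K \<Longrightarrow> m \<noteq> n - d \<Longrightarrow> cinner (U (embed m y) n) u = 0"
  obtains v where "v \<in> K" "\<And>n. U (embed (n - d) v) = embed n u"
    "\<And>n \<psi>. \<psi> \<in> direct_sum UNIV (\<lambda>_. K) \<Longrightarrow> cinner u (U \<psi> n) = cinner v (\<psi> (n - d))"
proof -
  let ?D = "direct_sum UNIV (\<lambda>_::int. K)"
  have emb: "embed n y \<in> ?D" if "y \<in> K" for n y
    using that K by (intro embed_in_direct_sum) auto
  have iso: "ds_inner UNIV (U \<psi>) (U \<phi>) = ds_inner UNIV \<psi> \<phi>" if "\<psi> \<in> ?D" "\<phi> \<in> ?D" for \<psi> \<phi>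
    using U that by (simp add: unitary_op_def)
  have "U ` ?D = ?D" using U by (simp add: unitary_op_def bij_betw_def)
  then have "\<forall>n. \<exists>\<xi>. \<xi> \<in> ?D \<and> U \<xi> = embed n u" using emb[OF u] by (metis image_iff)
  then obtain \<xi> where \<xi>: "\<And>n. \<xi> n \<in> ?D" "\<And>n. U (\<xi> n) = embed n u" by metis
  have \<xi>K: "\<xi> n m \<in> K" for n m using \<xi>(1)[of n] by (simp add: direct_sum_def)
  \<comment> \<open>Isometry turns the unknown components of the preimage into known matrix elements
    of \<open>U\<close>.\<close>
  have comp: "cinner y (\<xi> n m) = cinner (U (embed m y) n) u" if "y \<in> K" for y n m
    using iso[OF emb[OF that] \<xi>(1), of m n]
    by (simp add: \<xi>(2) ds_inner_embed_left ds_inner_embed_right)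
  have zero: "\<xi> n m = 0" if "m \<noteq> n - d" for n m
    by (rule cinner_ext_subspace[OF K \<xi>K]) (use that in \<open>auto simp: comp orth cvec.subspace_0[OF K]\<close>)
  \<comment> \<open>Vertex 0 serves as representative; by \<open>inv\<close> every \<open>n\<close>
    yields the same vector.\<close>
  define v where "v = \<xi> 0 (0 - d)"
  have "\<xi> n (n - d) = v" for n unfolding v_def
  proof (rule cinner_ext_subspace[OF K \<xi>K \<xi>K])
    show "cinner z (\<xi> n (n - d)) = cinner z (\<xi> 0 (0 - d))" if "z \<in> K" for z
      unfolding comp[OF that] inv[OF that, of n] by (rule refl)
  qed
  then have \<xi>_eq: "\<xi> n = embed (n - d) v" for n
    using zero by (auto simp: embed_def)
  show thesis
  proof
    show "v \<in> K" unfolding v_def by (rule \<xi>K)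
    show "U (embed (n - d) v) = embed n u" for n using \<xi>(2) \<xi>_eq by simp
    show "cinner u (U \<psi> n) = cinner v (\<psi> (n - d))" if "\<psi> \<in> ?D" for n \<psi>
      using iso[OF \<xi>(1) that, of n] unfolding \<xi>(2)
      by (simp add: \<xi>_eq ds_inner_embed_left)
  qed
qed

text \<open>The images of the two blocks are orthogonal lines spanned by \<open>u\<close> and
  \<open>w\<close>. Hence \<open>u\<close> at \<open>n\<close> is fed only from \<open>n - 1\<close>
  and \<open>w\<close> only from \<open>n + 1\<close>, and pulling them back through
  \<open>U\<close> gives \<open>v\<close> and \<open>v'\<close>.\<close>

lemma translation_invariant_walk_form:
  fixes K :: "'a::complex_inner set"
  assumes walk: "one_dimensional_walk (\<lambda>_. K) U"
    and inv: "translation_invariant (\<lambda>_. K) U"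
  obtains u w v v' where "onb2 K u w" "onb2 K v v'"
    "\<And>n \<psi>. \<psi> \<in> direct_sum UNIV (\<lambda>_. K) \<Longrightarrow> cinner u (U \<psi> n) = cinner v (\<psi> (n - 1))"
    "\<And>n \<psi>. \<psi> \<in> direct_sum UNIV (\<lambda>_. K) \<Longrightarrow> cinner w (U \<psi> n) = cinner v' (\<psi> (n + 1))"
proof -
  let ?D = "direct_sum UNIV (\<lambda>_::int. K)"
  have K: "cvec.subspace K" and dim: "cdim K = 2" and U: "unitary_op UNIV (\<lambda>_. K) U"
    using walk by (auto simp: one_dimensional_walk_def quantum_walk_def separable_hilbert_def)
  have zero: "U (embed m y) n = 0" if "y \<in> K" "\<bar>n - m\<bar> \<noteq> 1" for m n y
    using walk that by (simp add: one_dimensional_walk_def block_eq)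
  have step: "U (embed n y) m = U (embed (n + 1) y) (m + 1)" if "y \<in> K" for m n y
    using inv that unfolding translation_invariant_def block_eq by blast
  have shift: "U (embed (n - d) y) n = U (embed (0 - d) y) 0" if "y \<in> K" for n d y
  proof (rule int_shift_invariant[of "\<lambda>n. U (embed (n - d) y) n"])
    show "U (embed (k - d) y) k = U (embed (k + 1 - d) y) (k + 1)" for k
      using step[OF that, of "k - d" k] unfolding diff_add_eq .
  qed
  have emb: "embed n y \<in> ?D" if "y \<in> K" for n y
    using that K by (intro embed_in_direct_sum) auto
  have UK: "U \<psi> n \<in> K" if "\<psi> \<in> ?D" for \<psi> n
    using U that by (auto simp: unitary_op_def linear_op_def direct_sum_def)
  have iso: "ds_inner UNIV (U \<psi>) (U \<phi>) = ds_inner UNIV \<psi> \<phi>" if "\<psi> \<in> ?D" "\<phi> \<in> ?D" for \<psi> \<phi>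
    using U that by (simp add: unitary_op_def)
  define A where "A y = U (embed (0 - 1) y) 0" for y
  define B where "B y = U (embed (0 - - 1) y) 0" for y
  have A: "U (embed (n - 1) y) n = A y" if "y \<in> K" for n y
    unfolding A_def by (rule shift[OF that])
  have B: "U (embed (n - - 1) y) n = B y" if "y \<in> K" for n y
    unfolding B_def by (rule shift[OF that])
  have rank: "cdim (A ` K) = 1" "cdim (B ` K) = 1"
  proof -
    have "A = block U 0 (0 - 1)" "B = block U 0 (0 - - 1)"
      by (simp_all add: fun_eq_iff A_def B_def block_eq)
    then show "cdim (A ` K) = 1" "cdim (B ` K) = 1"
      using walk by (simp_all add: one_dimensional_walk_def block_rank_def)
  qed
  obtain a u where a: "a \<in> A ` K" and u: "norm u = 1"
      "u = complex_of_real (inverse (norm a)) *\<^sub>C a" "\<And>x. x \<in> A ` K \<Longrightarrow> \<exists>k. x = k *\<^sub>C u"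
    using cdim_1_obtain_unit[OF rank(1)] by blast
  obtain b w where b: "b \<in> B ` K" and w: "norm w = 1"
      "w = complex_of_real (inverse (norm b)) *\<^sub>C b" "\<And>x. x \<in> B ` K \<Longrightarrow> \<exists>k. x = k *\<^sub>C w"
    using cdim_1_obtain_unit[OF rank(2)] by blast
  have AB_K: "A y \<in> K" "B y \<in> K" if "y \<in> K" for y
    unfolding A_def B_def using UK[OF emb[OF that]] by auto
  have uK: "u \<in> K" and wK: "w \<in> K"
    using a b AB_K unfolding u(2) w(2) by (auto intro!: cvec.subspace_scale[OF K])
  have "cinner (A x) (B y) = 0" if x: "x \<in> K" and y: "y \<in> K" for x y
  proof -
    text \<open>The images of \<open>x\<close> at \<open>-1\<close> and of \<open>y\<close> at \<open>1\<close> meet only at \<open>0\<close>.\<close>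
    have "cinner (U (embed (-1) x) n) (U (embed 1 y) n) = cinner (embed 0 (A x) n) (B y)" for n
      using zero[OF x, of n "-1"] zero[OF y, of n 1] A[OF x, of 0] B[OF y, of 0]
      by (cases "n = 0"; cases "\<bar>n + 1\<bar> = 1"; cases "\<bar>n - 1\<bar> = 1") auto
    \<comment> \<open>A vector supported at 0 sees only the value there, so a constant family may
      stand in the second argument although it is in general not square-summable.\<close>
    then have "ds_inner UNIV (U (embed (-1) x)) (U (embed 1 y)) =
        ds_inner UNIV (embed 0 (A x)) (\<lambda>_::int. B y)"
      by (simp add: ds_inner_def)
    then show ?thesis
      using iso[OF emb[OF x] emb[OF y], of "-1" 1] by (simp add: ds_inner_embed_left)
  qed
  then have "cinner a b = 0" using a b by auto
  then have uw: "cinner u w = 0" unfolding u(2) w(2) by (simp add: cinner_simps)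
  have wu: "cinner w u = 0" by (rule cinner_eq_0_commute[OF uw])
  \<comment> \<open>Besides \<open>n - 1\<close>, only \<open>n + 1\<close> feeds \<open>n\<close>,
    and it does so along \<open>w\<close>, orthogonally to \<open>u\<close>.\<close>
  have orth_u: "cinner (U (embed m y) n) u = 0" if y: "y \<in> K" and m: "m \<noteq> n - 1" for m n y
  proof (cases "m = n - - 1")
    case True
    obtain k where "B y = k *\<^sub>C w" using w(3)[of "B y"] y by blast
    then show ?thesis using B[OF y] True by (simp add: cinner_simps wu)
  qed (use zero[of y n m] y m in auto)
  have orth_w: "cinner (U (embed m y) n) w = 0" if y: "y \<in> K" and m: "m \<noteq> n - - 1" for m n y
  proof (cases "m = n - 1")
    case True
    obtain k where "A y = k *\<^sub>C u" using u(3)[of "A y"] y by blast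
    then show ?thesis using A[OF y] True by (simp add: cinner_simps uw)
  qed (use zero[of y n m] y m in auto)
  obtain v where v: "v \<in> K" "\<And>n. U (embed (n - 1) v) = embed n u"
    "\<And>n \<psi>. \<psi> \<in> ?D \<Longrightarrow> cinner u (U \<psi> n) = cinner v (\<psi> (n - 1))"
    using unitary_preimage_embed[OF U K uK shift orth_u] by blast
  obtain v' where v': "v' \<in> K" "\<And>n. U (embed (n - - 1) v') = embed n w"
    "\<And>n \<psi>. \<psi> \<in> ?D \<Longrightarrow> cinner w (U \<psi> n) = cinner v' (\<psi> (n - - 1))"
    using unitary_preimage_embed[OF U K wK shift orth_w] by blast
  \<comment> \<open>Placed at 0, \<open>v\<close> and \<open>v'\<close> are sent to \<open>u\<close>
    at 1 and \<open>w\<close> at -1: unit vectors at different vertices.\<close>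
  have "cinner v v = 1" "cinner v' v' = 1" "cinner v v' = 0"
    using iso[OF emb[OF v(1)] emb[OF v(1)], of 0 0] v(2)[of 1]
      iso[OF emb[OF v'(1)] emb[OF v'(1)], of 0 0] v'(2)[of "-1"]
      iso[OF emb[OF v(1)] emb[OF v'(1)], of 0 0] u(1) w(1)
    by (simp_all add: ds_inner_embed_left cinner_self_unit)
  then have "onb2 K v v'"
    using v(1) v'(1) by (intro onb2I[OF K dim]) (simp_all add: norm_eq_1_iff_cinner)
  moreover have "onb2 K u w" using uK wK u(1) w(1) uw by (intro onb2I[OF K dim])
  ultimately show thesis using that v(3) v'(3) by simp
qed

section \<open>Factorisation into a coin and a flip-flop shift\<close>

theorem corollary6p5:
  fixes H :: "int \<Rightarrow> 'a::complex_inner set"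
    and U :: "(int \<Rightarrow> 'a) \<Rightarrow> (int \<Rightarrow> 'a)"
  assumes "one_dimensional_walk H U"
    and "translation_invariant H U"
  shows "szegedy_walk UNIV H U"
proof -
  define K where "K = H 0"
  have "H n = H (n + 1)" for n using assms(2) unfolding translation_invariant_def by blast
  from int_shift_invariant[of H, OF this] have H: "H = (\<lambda>_. K)" unfolding K_def by (rule ext)
  let ?D = "direct_sum UNIV (\<lambda>_::int. K)"
  note walk = assms(1)[unfolded H]
  have K: "cvec.subspace K"
    using walk by (simp add: one_dimensional_walk_def quantum_walk_def separable_hilbert_def)
  obtain u w v v' where uw: "onb2 K u w" and vv': "onb2 K v v'"
    and Uu: "\<And>n \<psi>. \<psi> \<in> ?D \<Longrightarrow> cinner u (U \<psi> n) = cinner v (\<psi> (n - 1))"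
    and Uw: "\<And>n \<psi>. \<psi> \<in> ?D \<Longrightarrow> cinner w (U \<psi> n) = cinner v' (\<psi> (n + 1))"
    using translation_invariant_walk_form[OF walk assms(2)[unfolded H]] by blast
  \<comment> \<open>\<open>U\<close> moves \<open>v\<close> at \<open>n\<close> to \<open>u\<close>
    at \<open>n + 1\<close>, and the flip-flop brings this back to \<open>w\<close> at
    \<open>n\<close>; so the coin has to send \<open>v\<close> to a multiple of
    \<open>w\<close>.\<close>
  obtain \<phi> \<alpha> where \<phi>: "\<phi> \<in> K" "norm \<phi> = 1" and \<alpha>: "cmod \<alpha> = 1" "coin \<phi> v = \<alpha> *\<^sub>C w"
    using coin_exchange[OF K, of v w] uw vv' by (auto simp: onb2_def)
  define \<beta> where "\<beta> = cinner u (coin \<phi> v')"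
  have "coin \<phi> v' \<in> K" using vv' by (intro coin_in_subspace K \<phi>) (simp add: onb2_def)
  from onb2_expand[OF uw this]
  have coin_v': "coin \<phi> v' = \<beta> *\<^sub>C u + cinner w (coin \<phi> v') *\<^sub>C w" by (simp add: \<beta>_def)
  \<comment> \<open>The coin preserves the orthogonality of \<open>v\<close> and \<open>v'\<close>,
    so the image of \<open>v'\<close> has no component along \<open>w\<close>.\<close>
  have "cnj \<alpha> * cinner w (coin \<phi> v') = cinner (coin \<phi> v) (coin \<phi> v')"
    by (simp add: \<alpha>(2) cinner_simps)
  also have "\<dots> = 0" by (simp add: cinner_coin[OF \<phi>(2)] onb2_cinner[OF vv'])
  finally have "cinner w (coin \<phi> v') = 0" using \<alpha>(1) by auto
  with coin_v' have coin_v': "coin \<phi> v' = \<beta> *\<^sub>C u" by simp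
  have "norm (coin \<phi> v') = 1"
    by (simp add: norm_eq_1_iff_cinner cinner_coin[OF \<phi>(2)] onb2_cinner[OF vv'])
  then have \<beta>: "cmod \<beta> = 1" using uw by (simp add: coin_v' norm_scaleC onb2_def)
  \<comment> \<open>The goal is \<open>cis l * \<gamma> = \<beta>\<close> and
    \<open>cis l * cnj \<gamma> = \<alpha>\<close>. Multiplying the two forces
    \<open>cis (2 * l) = \<alpha> * \<beta>\<close>, hence half the argument.\<close>
  define l where "l = Arg (\<alpha> * \<beta>) / 2"
  define \<gamma> where "\<gamma> = cis (- l) * \<beta>"
  have \<gamma>: "cmod \<gamma> = 1" by (simp add: \<gamma>_def norm_mult \<beta>)
  have e: "exp (\<i> * complex_of_real l) = cis l" by (simp add: cis_conv_exp)
  have g1: "cis l * \<gamma> = \<beta>" by (simp add: \<gamma>_def mult.assoc[symmetric] cis_mult)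
  have "\<alpha> * \<beta> = cis (l + l)"
    using rcis_cmod_Arg[of "\<alpha> * \<beta>"] by (simp add: l_def rcis_def norm_mult \<alpha> \<beta>)
  moreover have "\<beta> * cnj \<beta> = 1" using complex_norm_square[of \<beta>] \<beta> by simp
  ultimately have "cis l * (cis l * cnj \<beta>) = \<alpha>"
    by (simp only: mult.assoc[symmetric] cis_mult) (metis mult.assoc mult.right_neutral)
  then have g2: "cis l * cnj \<gamma> = \<alpha>" by (simp add: \<gamma>_def cis_cnj)
  have "cis l *\<^sub>C flip_flop \<gamma> u w (U \<psi>) n = coin \<phi> (\<psi> n)" if \<psi>: "\<psi> \<in> ?D" for \<psi> n
  proof -
    have "\<psi> n \<in> K" using \<psi> by (simp add: direct_sum_def)
    from onb2_expand[OF vv' this]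
    have "coin \<phi> (\<psi> n) = coin \<phi> (cinner v (\<psi> n) *\<^sub>C v + cinner v' (\<psi> n) *\<^sub>C v')" by simp
    also have "\<dots> = (cinner v' (\<psi> n) * \<beta>) *\<^sub>C u + (cinner v (\<psi> n) * \<alpha>) *\<^sub>C w"
      by (simp add: coin_add coin_scaleC \<alpha>(2) coin_v' scaleC_scaleC add.commute)
    also have "\<dots> = cis l *\<^sub>C flip_flop \<gamma> u w (U \<psi>) n"
      by (simp add: flip_flop_def Uu[OF \<psi>] Uw[OF \<psi>] scaleC_add_right scaleC_scaleC
          g1[symmetric] g2[symmetric] mult_ac)
    finally show ?thesis by simp
  qed
  then have "\<forall>\<psi>\<in>?D. (\<lambda>n. exp (\<i> * complex_of_real l) *\<^sub>C flip_flop \<gamma> u w (U \<psi>) n) =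
      sum_op UNIV (\<lambda>_. coin \<phi>) \<psi>"
    by (simp add: e sum_op_def)
  then show ?thesis
    unfolding szegedy_walk_def H
    using one_dimensional_standard[OF walk] unitary_flip_flop[OF K uw \<gamma>]
      self_adjoint_flip_flop[OF K uw \<gamma>] \<phi>
    by (intro conjI exI[of _ "flip_flop \<gamma> u w"] exI[of _ l] exI[of _ "\<lambda>_. \<phi>"]) auto
qed

end
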